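(* Let $m\ge 1$ and let $D = D(a_1, a_2, \ldots , a_m)$ be a positive diagram or a negative diagram of a $2$-bridge knot such that $a_i > 0$ for all $1 \leq i \leq m$. Then $D$ must be of one of the following forms. (1) When $m$ is even, say $m = 2n$, either (a1) $a_{2i}$ is even for $1 \leq i \leq n-1$, (a2) $a_{2n}$ is odd, and (a3) $\sum_{i=1}^{n} a_{2i-1}$ is even; or (b1) $a_1$ is odd, (b2) $a_{2i-1}$ is even for $2 \leq i \leq n$, and (b3) $\sum_{i=1}^{n} a_{2i}$ is even. (2) When $m$ is odd, say $m = 2n + 1$, either (a1) $a_{2i-1}$ is even for $2 \leq i \leq n$, (a2) $a_1$ and $a_{2n+1}$ are odd, and (a3) $\sum_{i=1}^{n} a_{2i}$ is odd; or (b1) $a_{2i}$ is even for $1\leq i \leq n$, and (b2) $\sum_{i=1}^{n+1} a_{2i-1}$ is odd.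
   Context: **Positive/negative diagram.** An oriented knot diagram is positive (negative) if all its crossings have sign $+$ (sign $-$). **The diagram $D(a_1,\dots,a_m)$.** Take four horizontal strings at heights $1,2,3,4$ from top to bottom. From left to right insert twist regions ("rectangles") $(a_1),(a_2),\dots,(a_m)$. For $i$ odd, $(a_i)$ is in the lower row and consists of $|a_i|$ horizontal half-twists between the strings at heights $2$ and $3$, right-handed if $a_i\ge0$ and left-handed if $a_i<0$. For $i$ even, $(a_i)$ is in the upper row and consists of $|a_i|$ horizontal half-twists between the strings at heights $1$ and $2$, left-handed if $a_i\ge 0$ and right-handed if $a_i<0$. (A half-twist is right-handed if its crossing is positive when both its strands are oriented from left to right, and left-handed otherwise.) The string at height $4$ is never twisted. On the left, ends $1,2$ are joined by an arc and ends $3,4$ are joined by an arc. On the right, if $m$ is odd ends $1,2$ are joined and ends $3,4$ are joined; if $m$ is even ends $2,3$ are joined and ends $1,4$ are joined. No further crossings are created. If all $a_i>0$ the diagram is alternating. A knot with such a diagram (the diagram has one component) is called a $2$-bridge knot. *)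

theory Defs
  imports Main "HOL-Combinatorics.Transposition"
begin

text \<open>
  Diagrams drawn on four horizontal strings. The strings have heights 1, 2, 3, 4, counted from top
  to bottom, and the crossings are listed from left to right, no two in the same column. A
  crossing exchanges the strings at two neighbouring heights h and h + 1, so one of its strands
  descends from the upper left to the lower right and the other ascends from the lower left to the
  upper right; the crossing records which of the two is the overstrand.
\<close>

datatype slope = Descending | Ascending

record crossing =
  upper :: nat  \<comment> \<open>the smaller of the two heights involved\<close>
  over :: slope

record diagram =
  crossings :: "crossing list"
  left_arcs :: "(nat \<times> nat) set"   \<comment> \<open>pairs of heights joined by an arc at the left end\<close>
  right_arcs :: "(nat \<times> nat) set"  \<comment> \<open>pairs of heights joined by an arc at the right end\<close>


text \<open>
  With N crossings there are N + 1 columns of marked points: the point (k, h) lies on the string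
  at height h, immediately to the left of crossing number k (numbered from 0), or at the right end
  if k = N. The marked points cut the link into pieces, namely the four strands between two
  consecutive columns and the closing arcs.
\<close>

type_synonym point = "nat \<times> nat"

definition points :: "diagram \<Rightarrow> point set" where
  "points D = {0..length (crossings D)} \<times> {1..4}"

definition strands :: "diagram \<Rightarrow> (point \<times> point) set" where
  "strands D =
     {((k, h), (Suc k, transpose (upper c) (Suc (upper c)) h)) | k h c.
        k < length (crossings D) \<and> c = crossings D ! k \<and> h \<in> {1..4}}"

definition arcs :: "diagram \<Rightarrow> (point \<times> point) set" where
  "arcs D =
     {((0, p), (0, q)) | p q. (p, q) \<in> left_arcs D} \<union>
     {((length (crossings D), p), (length (crossings D), q)) | p q. (p, q) \<in> right_arcs D}"

definition same_component :: "diagram \<Rightarrow> (point \<times> point) set" where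
  "same_component D =
     (let J = strands D \<union> arcs D in (J \<union> J\<inverse>)\<^sup>* \<inter> points D \<times> points D)"

definition components :: "diagram \<Rightarrow> point set set" where
  "components D = points D // same_component D"

definition knot_diagram :: "diagram \<Rightarrow> bool" where
  "knot_diagram D \<longleftrightarrow> card (components D) = 1"


text \<open>
  An orientation gives the direction of travel at each marked point. It is constant along a strand,
  whereas a closing arc turns around. Values outside the set of marked points play no role.
\<close>

datatype direction = Rightward | Leftward

definition orientation :: "diagram \<Rightarrow> (point \<Rightarrow> direction) \<Rightarrow> bool" where
  "orientation D d \<longleftrightarrow>
     (\<forall>(P, Q) \<in> strands D. d P = d Q) \<and> (\<forall>(P, Q) \<in> arcs D. d P \<noteq> d Q)"

text \<open>
  Tangent vectors are taken in the plane with the x-axis pointing to the right and the y-axis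
  pointing upwards. A crossing is positive iff the tangent vector of the overstrand followed by
  that of the understrand is a positively oriented basis.
\<close>

fun tangent :: "slope \<Rightarrow> direction \<Rightarrow> int \<times> int" where
  "tangent Descending Rightward = (1, -1)"
| "tangent Descending Leftward = (-1, 1)"
| "tangent Ascending Rightward = (1, 1)"
| "tangent Ascending Leftward = (-1, -1)"

definition det2 :: "int \<times> int \<Rightarrow> int \<times> int \<Rightarrow> int" where
  "det2 u v = fst u * snd v - snd u * fst v"

text \<open>Here \<open>d1\<close> and \<open>d2\<close> are the directions of the descending and of the ascending strand.\<close>

definition crossing_sign :: "crossing \<Rightarrow> direction \<Rightarrow> direction \<Rightarrow> int" where
  "crossing_sign c d1 d2 =
     (case over c of
        Descending \<Rightarrow> sgn (det2 (tangent Descending d1) (tangent Ascending d2))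
      | Ascending \<Rightarrow> sgn (det2 (tangent Ascending d2) (tangent Descending d1)))"

definition sign_at :: "diagram \<Rightarrow> (point \<Rightarrow> direction) \<Rightarrow> nat \<Rightarrow> int" where
  "sign_at D d k =
     (let c = crossings D ! k in crossing_sign c (d (k, upper c)) (d (k, Suc (upper c))))"

definition positive_diagram :: "diagram \<Rightarrow> (point \<Rightarrow> direction) \<Rightarrow> bool" where
  "positive_diagram D d \<longleftrightarrow> (\<forall>k < length (crossings D). sign_at D d k = 1)"

definition negative_diagram :: "diagram \<Rightarrow> (point \<Rightarrow> direction) \<Rightarrow> bool" where
  "negative_diagram D d \<longleftrightarrow> (\<forall>k < length (crossings D). sign_at D d k = -1)"


definition right_half_twist :: "nat \<Rightarrow> crossing" where
  "right_half_twist h = \<lparr>upper = h, over = Descending\<rparr>"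

definition left_half_twist :: "nat \<Rightarrow> crossing" where
  "left_half_twist h = \<lparr>upper = h, over = Ascending\<rparr>"

lemma sign_right_half_twist: "crossing_sign (right_half_twist h) Rightward Rightward = 1"
  by (simp add: crossing_sign_def right_half_twist_def det2_def)

lemma sign_left_half_twist: "crossing_sign (left_half_twist h) Rightward Rightward = -1"
  by (simp add: crossing_sign_def left_half_twist_def det2_def)

definition twist_region :: "nat \<Rightarrow> int \<Rightarrow> crossing list" where
  "twist_region i x =
     replicate (nat \<bar>x\<bar>)
       (if odd i then (if x \<ge> 0 then right_half_twist 2 else left_half_twist 2)
        else (if x \<ge> 0 then left_half_twist 1 else right_half_twist 1))"

text \<open>The diagram \<open>D(a\<^sub>1, \<dots>, a\<^sub>m)\<close>; only the values of \<open>a\<close> on \<open>{1..m}\<close> matter.\<close>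

definition two_bridge_diagram :: "nat \<Rightarrow> (nat \<Rightarrow> int) \<Rightarrow> diagram" where
  "two_bridge_diagram m a =
     \<lparr>crossings = concat (map (\<lambda>i. twist_region i (a i)) [1..<Suc m]),
      left_arcs = {(1, 2), (3, 4)},
      right_arcs = (if odd m then {(1, 2), (3, 4)} else {(2, 3), (1, 4)})\<rparr>"

end

theory Submission
  imports Defs
begin

text \<open>
  The directions of the strings at any column are those at the left end, carried along by the
  permutation of the heights read so far. Homogeneity of the signs says, for the two strings that
  meet in a twist region, whether they are parallel: in a positive diagram they are parallel in the
  lower row and antiparallel in the upper row, in a negative diagram the other way round. A region
  of parallel strings does not change the pattern of directions, so every other region must consist
  of an even number of half-twists until the pattern is allowed to change, at the first region
  or the last. The remaining parity condition holds because otherwise the strings that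
  start at heights 1 and 2 close up among themselves, giving two components.
\<close>

section \<open>Tracing strings back to the left end\<close>

text \<open>The height at the left end of the string that has height \<open>h\<close> after the crossings \<open>cs\<close>.\<close>

definition origin :: "crossing list \<Rightarrow> nat \<Rightarrow> nat" where
  "origin cs = foldr (\<lambda>c g. transpose (upper c) (Suc (upper c)) \<circ> g) cs id"

lemma origin_Nil [simp]: "origin [] = id"
  by (simp add: origin_def)

lemma origin_Cons [simp]: "origin (c # cs) = transpose (upper c) (Suc (upper c)) \<circ> origin cs"
  by (simp add: origin_def)

lemma origin_append [simp]: "origin (xs @ ys) = origin xs \<circ> origin ys"
  by (induction xs) (simp_all add: comp_assoc)

lemma origin_replicate:
  "origin (replicate n c) = (if even n then id else transpose (upper c) (Suc (upper c)))"
  by (induction n) auto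

lemma orientation_eq_origin:
  assumes "orientation D d" and "\<forall>c \<in> set (crossings D). upper c \<in> {1..3}"
    and "k \<le> length (crossings D)" and "h \<in> {1..4}"
  shows "d (k, h) = d (0, origin (take k (crossings D)) h)"
  using assms(3,4)
proof (induction k arbitrary: h)
  case 0
  then show ?case by simp
next
  case (Suc k)
  define c where "c = crossings D ! k"
  \<comment> \<open>A transposition is its own inverse, so the strand that starts at
    \<open>h'\<close> in column \<open>k\<close> ends at \<open>h\<close> in column
    \<open>Suc k\<close>.\<close>
  define h' where "h' = transpose (upper c) (Suc (upper c)) h"
  have "upper c \<in> {1..3}"
    using assms(2) Suc.prems(1) by (simp add: c_def)
  then have h': "h' \<in> {1..4}"
    using Suc.prems(2) by (auto simp: h'_def transpose_def)
  have "((k, h'), (Suc k, transpose (upper c) (Suc (upper c)) h')) \<in> strands D"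
    using h' Suc.prems(1) by (auto simp: strands_def c_def)
  then have "d (k, h') = d (Suc k, h)"
    using assms(1) by (fastforce simp: orientation_def h'_def)
  moreover have "d (k, h') = d (0, origin (take k (crossings D)) h')"
    using Suc h' by simp
  ultimately show ?case
    using Suc.prems(1) by (simp add: take_Suc_conv_app_nth c_def h'_def)
qed

section \<open>Detecting several components by colourings\<close>

text \<open>A colouring that no strand or arc changes is constant on each component, so two colours
  force two components.\<close>

lemma not_knot_if_colouring:
  assumes "\<And>P Q. (P, Q) \<in> strands D \<union> arcs D \<Longrightarrow> f P = f Q"
    and "P \<in> points D" "Q \<in> points D" "f P \<noteq> f Q"
  shows "\<not> knot_diagram D"
proof
  define J where "J = strands D \<union> arcs D"
  assume "knot_diagram D"
  then obtain C where C: "components D = {C}"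
    by (auto simp: knot_diagram_def card_1_singleton_iff)
  have mem: "same_component D `` {R} = C" if "R \<in> points D" for R
    using that C by (auto simp: components_def quotient_def)
  have "Q \<in> same_component D `` {Q}"
    using assms(3) by (auto simp: same_component_def Let_def)
  then have "Q \<in> same_component D `` {P}"
    using mem assms(2,3) by simp
  then have "(P, Q) \<in> (J \<union> J\<inverse>)\<^sup>*"
    by (auto simp: same_component_def Let_def J_def)
  then have "f P = f Q"
  proof (induction rule: rtrancl_induct)
    case (step R S)
    then have "(R, S) \<in> J \<or> (S, R) \<in> J"
      by auto
    then show ?case
      using step.IH assms(1)[of R S] assms(1)[of S R] by (auto simp: J_def)
  qed simp
  with assms(4) show False by simp
qed

text \<open>Each marked point inherits the colour of the left end of its string. Strands then
  respect the colouring by construction, and only the closing arcs remain to be checked.\<close>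

lemma not_knot_if_separated:
  assumes "\<And>p q. (p, q) \<in> left_arcs D \<Longrightarrow> f p = f q"
    and "\<And>p q. (p, q) \<in> right_arcs D \<Longrightarrow>
           f (origin (crossings D) p) = f (origin (crossings D) q)"
    and "p \<in> {1..4}" "q \<in> {1..4}" "f p \<noteq> f q"
  shows "\<not> knot_diagram D"
proof (rule not_knot_if_colouring)
  let ?g = "\<lambda>(k, h). f (origin (take k (crossings D)) h)"
  show "?g P = ?g Q" if "(P, Q) \<in> strands D \<union> arcs D" for P Q
    using that assms(1,2)
    by (auto simp: strands_def arcs_def take_Suc_conv_app_nth)
  show "(0, p) \<in> points D" "(0, q) \<in> points D" "?g (0, p) \<noteq> ?g (0, q)"
    using assms(3-5) by (auto simp: points_def)
qed

section \<open>Crossings and permutations of the twist regions\<close>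

lemma arcs_two_bridge:
  "left_arcs (two_bridge_diagram m a) = {(1, 2), (3, 4)}"
  "right_arcs (two_bridge_diagram m a) = (if odd m then {(1, 2), (3, 4)} else {(2, 3), (1, 4)})"
  by (simp_all add: two_bridge_diagram_def)

abbreviation origin_after :: "(nat \<Rightarrow> int) \<Rightarrow> nat \<Rightarrow> nat \<Rightarrow> nat" where
  "origin_after a i \<equiv> origin (crossings (two_bridge_diagram i a))"

lemma origin_after_0: "origin_after a 0 = id"
  by (simp add: two_bridge_diagram_def)

text \<open>Half-twists in one region repeat a single transposition, so only the parity of their
  number survives. Region \<open>Suc i\<close> lies in the lower row when \<open>i\<close> is
  even.\<close>

lemma origin_after_Suc:
  "origin_after a (Suc i) = origin_after a i \<circ>
     (if even (a (Suc i)) then id else if even i then transpose 2 3 else transpose 1 2)"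
  by (simp add: two_bridge_diagram_def twist_region_def origin_replicate even_nat_iff
      right_half_twist_def left_half_twist_def flip: numeral_2_eq_2)

lemma crossings_two_bridge_split:
  assumes "i < m"
  obtains cs where "crossings (two_bridge_diagram m a) =
    crossings (two_bridge_diagram i a) @ twist_region (Suc i) (a (Suc i)) @ cs"
proof -
  have "[1..<Suc m] = [1..<Suc i] @ [Suc i] @ [Suc (Suc i)..<Suc m]"
    using assms upt_add_eq_append[of 1 "Suc i" "m - i"] upt_conv_Cons[of "Suc i" "Suc m"]
    by simp
  then show thesis
    using that by (simp add: two_bridge_diagram_def)
qed

lemma upper_two_bridge: "c \<in> set (crossings (two_bridge_diagram m a)) \<Longrightarrow> upper c \<in> {1..2}"
  by (auto simp: two_bridge_diagram_def twist_region_def right_half_twist_def left_half_twist_def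
      split: if_splits)

text \<open>Reversing one strand negates the determinant, so the sign depends only on whether the
  strands are parallel.\<close>

lemma crossing_sign_half_twist:
  "crossing_sign (right_half_twist h) x y = (if x = y then 1 else -1)"
  "crossing_sign (left_half_twist h) x y = (if x = y then -1 else 1)"
  by (cases x; cases y; simp add: crossing_sign_def right_half_twist_def left_half_twist_def det2_def)+

text \<open>Adds the parities of two regions in the same row once the region between them is known
  to act trivially.\<close>

lemma twist_comp:
  "(if P then id else transpose x y) \<circ> (if Q then id else transpose x y) =
     (if P = Q then id else transpose x y)"
  by simp

text \<open>Stated with \<open>Suc 0\<close>, the simplifier's normal form of the height 1.\<close>

lemma transpose_heights:
  "transpose (Suc 0) (2::nat) (Suc 0) = 2" "transpose (Suc 0) (2::nat) 2 = Suc 0"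
  "transpose (Suc 0) (2::nat) 3 = 3" "transpose (Suc 0) (2::nat) 4 = 4"
  "transpose (2::nat) 3 (Suc 0) = Suc 0" "transpose (2::nat) 3 2 = 3"
  "transpose (2::nat) 3 3 = 2" "transpose (2::nat) 3 4 = 4"
  by (simp_all add: transpose_def)

section \<open>Knot diagrams whose crossings share one sign\<close>

text \<open>The common sign \<open>s\<close> lets positive and negative diagrams share everything up
  to the case split on its value.\<close>

locale homogeneous_knot =
  fixes m :: nat and a :: "nat \<Rightarrow> int" and d :: "point \<Rightarrow> direction" and s :: int
  assumes pos: "\<And>i. 1 \<le> i \<Longrightarrow> i \<le> m \<Longrightarrow> a i > 0"
    and knot: "knot_diagram (two_bridge_diagram m a)"
    and ori: "orientation (two_bridge_diagram m a) d"
    and sign: "\<And>k. k < length (crossings (two_bridge_diagram m a)) \<Longrightarrow>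
                 sign_at (two_bridge_diagram m a) d k = s"
begin

definition e :: "nat \<Rightarrow> direction" where
  "e h = d (0, h)"

lemma direction_eq_origin:
  assumes "k \<le> length (crossings (two_bridge_diagram m a))" "h \<in> {1..4}"
  shows "d (k, h) = e (origin (take k (crossings (two_bridge_diagram m a))) h)"
  unfolding e_def using orientation_eq_origin[OF ori _ assms] upper_two_bridge by fastforce

lemma left_end: "e 1 \<noteq> e 2" "e 3 \<noteq> e 4"
proof -
  have "((0, 1), (0, 2)) \<in> arcs (two_bridge_diagram m a)"
    "((0, 3), (0, 4)) \<in> arcs (two_bridge_diagram m a)"
    by (simp_all add: arcs_def two_bridge_diagram_def)
  then show "e 1 \<noteq> e 2" "e 3 \<noteq> e 4"
    using ori by (auto simp: e_def orientation_def)
qed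

lemma right_end:
  assumes "(p, q) \<in> right_arcs (two_bridge_diagram m a)"
  shows "e (origin_after a m p) \<noteq> e (origin_after a m q)"
proof -
  let ?N = "length (crossings (two_bridge_diagram m a))"
  have "((?N, p), (?N, q)) \<in> arcs (two_bridge_diagram m a)"
    using assms by (simp add: arcs_def)
  then have "d (?N, p) \<noteq> d (?N, q)"
    using ori by (auto simp: orientation_def)
  moreover have "p \<in> {1..4}" "q \<in> {1..4}"
    using assms by (auto simp: two_bridge_diagram_def split: if_splits)
  ultimately show ?thesis
    by (simp add: direction_eq_origin)
qed

lemma right_end_odd:
  assumes "odd m"
  shows "e (origin_after a m 1) \<noteq> e (origin_after a m 2)"
    "e (origin_after a m 3) \<noteq> e (origin_after a m 4)"
  by (intro right_end; simp add: assms arcs_two_bridge)+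

lemma right_end_even:
  assumes "even m"
  shows "e (origin_after a m 2) \<noteq> e (origin_after a m 3)"
    "e (origin_after a m 1) \<noteq> e (origin_after a m 4)"
  by (intro right_end; simp add: assms arcs_two_bridge)+

text \<open>The first crossing of region \<open>Suc i\<close> compares the two strings that enter
  the region, and its sign must be \<open>s\<close>.\<close>

lemma region_sign:
  assumes "i < m"
  shows "even i \<Longrightarrow> s = (if e (origin_after a i 2) = e (origin_after a i 3) then 1 else -1)"
    and "odd i \<Longrightarrow> s = (if e (origin_after a i 1) = e (origin_after a i 2) then -1 else 1)"
proof -
  let ?D = "two_bridge_diagram m a"
  let ?k = "length (crossings (two_bridge_diagram i a))"
  \<comment> \<open>Positivity of \<open>a (Suc i)\<close> fixes the handedness, so \<open>c\<close>
    is the crossing repeated in that region; it also makes the region nonempty, so that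
    \<open>c\<close> sits at position \<open>?k\<close>.\<close>
  define c where "c = (if even i then right_half_twist 2 else left_half_twist 1)"
  obtain cs where cs: "crossings ?D =
      crossings (two_bridge_diagram i a) @ twist_region (Suc i) (a (Suc i)) @ cs"
    using crossings_two_bridge_split[OF assms] .
  have "a (Suc i) > 0"
    using pos assms by simp
  then obtain r where "twist_region (Suc i) (a (Suc i)) = c # r"
    by (cases "nat (a (Suc i))") (auto simp: twist_region_def c_def)
  then have k: "?k < length (crossings ?D)" "crossings ?D ! ?k = c"
    "take ?k (crossings ?D) = crossings (two_bridge_diagram i a)"
    using cs by simp_all
  have dir: "d (?k, h) = e (origin_after a i h)" if "h \<in> {1..4}" for h
    using direction_eq_origin[of ?k h] k that by simp
  have s: "s = crossing_sign c (d (?k, upper c)) (d (?k, Suc (upper c)))"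
    using sign[OF k(1)] k(2) by (simp add: sign_at_def)
  show "s = (if e (origin_after a i 2) = e (origin_after a i 3) then 1 else -1)" if "even i"
    using s that dir[of 2] dir[of 3]
    by (simp add: c_def crossing_sign_half_twist) (simp add: right_half_twist_def)
  show "s = (if e (origin_after a i 1) = e (origin_after a i 2) then -1 else 1)" if "odd i"
    using s that dir[of 1] dir[of 2]
    by (simp add: c_def crossing_sign_half_twist) (simp add: left_half_twist_def numeral_2_eq_2)
qed

text \<open>The left arcs pair strings 1, 2 and 3, 4. If the right arcs also respect these two
  pairs, colouring by \<open>h \<le> 2\<close> splits the diagram.\<close>

lemma not_separated:
  assumes "\<And>p q. (p, q) \<in> right_arcs (two_bridge_diagram m a) \<Longrightarrow>
             origin_after a m p \<le> 2 \<longleftrightarrow> origin_after a m q \<le> 2"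
  shows False
proof -
  have "\<not> knot_diagram (two_bridge_diagram m a)"
    by (rule not_knot_if_separated[where f = "\<lambda>h. h \<le> 2" and p = 1 and q = 4])
      (use assms in \<open>auto simp: arcs_two_bridge\<close>)
  with knot show False by contradiction
qed

lemma not_separated_odd:
  assumes "odd m"
  shows "\<not> ((origin_after a m 1 \<le> 2 \<longleftrightarrow> origin_after a m 2 \<le> 2) \<and>
            (origin_after a m 3 \<le> 2 \<longleftrightarrow> origin_after a m 4 \<le> 2))"
  by (intro notI not_separated) (use assms in \<open>auto simp: arcs_two_bridge\<close>)

lemma not_separated_even:
  assumes "even m"
  shows "\<not> ((origin_after a m 2 \<le> 2 \<longleftrightarrow> origin_after a m 3 \<le> 2) \<and>
            (origin_after a m 1 \<le> 2 \<longleftrightarrow> origin_after a m 4 \<le> 2))"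
  by (intro notI not_separated) (use assms in \<open>auto simp: arcs_two_bridge\<close>)

lemma odd_region:
  "origin_after a (Suc (2 * n)) =
     origin_after a (2 * n) \<circ> (if even (a (Suc (2 * n))) then id else transpose 2 3)"
  by (simp add: origin_after_Suc)

lemma even_region:
  "origin_after a (2 * Suc n) =
     origin_after a (Suc (2 * n)) \<circ> (if even (a (2 * Suc n)) then id else transpose 1 2)"
  by (simp add: origin_after_Suc)

section \<open>Parity of the regions before the last one\<close>

lemma positive_left_end: "s = 1 \<Longrightarrow> 0 < m \<Longrightarrow> e 3 = e 2"
  using region_sign(1)[of 0] by (simp add: origin_after_0 split: if_splits)

lemma negative_left_end:
  assumes "s = -1" and "0 < m"
  shows "e 3 = e 1" "e 4 = e 2"
proof -
  have "e 2 \<noteq> e 3"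
    using region_sign(1)[of 0] assms by (simp add: origin_after_0 split: if_splits)
  then show "e 3 = e 1" "e 4 = e 2"
    using left_end by (metis direction.exhaust)+
qed

text \<open>Strings 2 and 3 are parallel and string 1 is opposite to them. Lower regions only
  exchange 2 and 3, while an odd upper region would send string 1 into the next lower region beside
  one of them. The bound \<open>2 * n < m\<close> guarantees that this next region exists.\<close>

lemma positive_prefix:
  assumes "s = 1" and "2 * n < m"
  shows "(\<forall>i\<in>{1..n}. even (a (2 * i))) \<and>
         origin_after a (Suc (2 * n)) =
           (if even (\<Sum>i = 1..Suc n. a (2 * i - 1)) then id else transpose 2 3)"
  using assms(2)
proof (induction n)
  case 0
  then show ?case
    using odd_region[of 0] by (simp add: origin_after_0)
next
  case (Suc n)
  define b where "b = even (\<Sum>i = 1..Suc n. a (2 * i - 1))"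
  have prev: "origin_after a (Suc (2 * n)) = (if b then id else transpose 2 3)"
    using Suc unfolding b_def by simp
  have "e (origin_after a (2 * Suc n) 2) = e (origin_after a (2 * Suc n) 3)"
    using region_sign(1)[of "2 * Suc n"] Suc.prems assms(1) by (simp split: if_splits)
  \<comment> \<open>If odd, the strings at heights 2 and 3 would be string 1 and one of 2,
    3.\<close>
  then have ev: "even (a (2 * Suc n))"
    using positive_left_end[OF assms(1)] left_end(1) Suc.prems unfolding even_region prev
    by (intro ccontr[of "even _"]; cases b) (simp_all add: transpose_heights)
  have "origin_after a (Suc (2 * Suc n)) =
      (if b = even (a (Suc (2 * Suc n))) then id else transpose 2 3)"
    unfolding odd_region[of "Suc n"] even_region prev if_P[OF ev] comp_id twist_comp ..
  moreover have "even (\<Sum>i = 1..Suc (Suc n). a (2 * i - 1)) \<longleftrightarrow> b = even (a (Suc (2 * Suc n)))"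
    by (simp add: b_def)
  moreover have "\<forall>i\<in>{1..Suc n}. even (a (2 * i))"
    using Suc ev by (auto simp: atLeastAtMostSuc_conv)
  ultimately show ?case
    by presburger
qed

text \<open>Strings 1 and 3 are parallel, as are 2 and 4. Region 2 needs parallel strings, so region
  1 must bring 3 next to 1. Upper regions then only exchange 1 and 3, and another odd lower region
  before an upper one would put string 2 back beside one of them.\<close>

lemma negative_prefix:
  assumes "s = -1" and "Suc (2 * n) < m"
  shows "odd (a 1) \<and> (\<forall>i\<in>{2..Suc n}. even (a (2 * i - 1))) \<and>
         origin_after a (2 * Suc n) = transpose 2 3 \<circ>
           (if even (\<Sum>i = 1..Suc n. a (2 * i)) then id else transpose 1 2)"
  using assms(2)
proof (induction n)
  case 0
  have "e (origin_after a 1 1) = e (origin_after a 1 2)"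
    using region_sign(2)[of 1] 0 assms(1) by (simp split: if_splits)
  then have "odd (a 1)"
    using left_end odd_region[of 0] by (auto simp: origin_after_0)
  then show ?case
    using odd_region[of 0] even_region[of 0] by (simp add: origin_after_0)
next
  case (Suc n)
  define b where "b = even (\<Sum>i = 1..Suc n. a (2 * i))"
  have "Suc (2 * n) < m"
    using Suc.prems by simp
  note IH = Suc.IH[OF this]
  then have prev: "origin_after a (2 * Suc n) = transpose 2 3 \<circ> (if b then id else transpose 1 2)"
    unfolding b_def by blast
  have "e (origin_after a (Suc (2 * Suc n)) 1) = e (origin_after a (Suc (2 * Suc n)) 2)"
    using region_sign(2)[of "Suc (2 * Suc n)"] Suc.prems assms(1) by (simp split: if_splits)
  \<comment> \<open>If odd, string 2 would be at height 2, opposite to the string at height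
    1.\<close>
  then have ev: "even (a (Suc (2 * Suc n)))"
    using negative_left_end[OF assms(1)] left_end(1) Suc.prems unfolding odd_region prev
    by (intro ccontr[of "even _"]; cases b) (simp_all add: transpose_heights)
  have "origin_after a (2 * Suc (Suc n)) = transpose 2 3 \<circ>
      (if b = even (a (2 * Suc (Suc n))) then id else transpose 1 2)"
    unfolding even_region[of "Suc n"] odd_region[of "Suc n"] prev if_P[OF ev] comp_id
      comp_assoc twist_comp ..
  moreover have "even (\<Sum>i = 1..Suc (Suc n). a (2 * i)) \<longleftrightarrow> b = even (a (2 * Suc (Suc n)))"
    by (simp add: b_def)
  moreover have "\<forall>i\<in>{2..Suc (Suc n)}. even (a (2 * i - 1))"
    using IH ev by (auto simp: atLeastAtMostSuc_conv)
  ultimately show ?case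
    using IH by presburger
qed

section \<open>Conditions imposed by the right end\<close>

lemma positive_end_even:
  assumes "s = 1" and m: "m = 2 * Suc n"
  shows "(\<forall>i\<in>{1..n}. even (a (2 * i))) \<and> odd (a (2 * Suc n)) \<and>
         even (\<Sum>i = 1..Suc n. a (2 * i - 1))"
proof -
  define b where "b = even (\<Sum>i = 1..Suc n. a (2 * i - 1))"
  have prefix: "\<forall>i\<in>{1..n}. even (a (2 * i))"
    "origin_after a (Suc (2 * n)) = (if b then id else transpose 2 3)"
    using positive_prefix[OF assms(1), of n] m unfolding b_def by simp_all
  have "even m"
    using m by simp
  note right = right_end_even[OF this] not_separated_even[OF this]
  \<comment> \<open>Otherwise the right arc at heights 2 and 3 would join the parallel strings 2 and
    3.\<close>
  have "odd (a (2 * Suc n))"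
    using right(1) positive_left_end assms unfolding m even_region prefix(2)
    by (cases b) (auto simp: transpose_heights)
  \<comment> \<open>If \<open>b\<close> failed, the right arcs would join 1 with 2 and 3 with 4, as
    on the left.\<close>
  moreover from this have b
    using right(3) unfolding m even_region prefix(2)
    by (cases b) (auto simp: transpose_heights)
  ultimately show ?thesis
    using prefix(1) unfolding b_def by blast
qed

lemma positive_end_odd:
  assumes "s = 1" and m: "m = Suc (2 * n)"
  shows "(\<forall>i\<in>{1..n}. even (a (2 * i))) \<and> odd (\<Sum>i = 1..Suc n. a (2 * i - 1))"
proof -
  define b where "b = even (\<Sum>i = 1..Suc n. a (2 * i - 1))"
  have prefix: "\<forall>i\<in>{1..n}. even (a (2 * i))"
    "origin_after a m = (if b then id else transpose 2 3)"
    using positive_prefix[OF assms(1), of n] m unfolding b_def by simp_all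
  \<comment> \<open>Under \<open>b\<close> the permutation is the identity, and both ends join the
    same pairs.\<close>
  have "\<not> b"
    using not_separated_odd m unfolding prefix(2) by (cases b) auto
  then show ?thesis
    using prefix(1) unfolding b_def by blast
qed

lemma negative_end_even:
  assumes "s = -1" and m: "m = 2 * Suc n"
  shows "odd (a 1) \<and> (\<forall>i\<in>{2..Suc n}. even (a (2 * i - 1))) \<and>
         even (\<Sum>i = 1..Suc n. a (2 * i))"
proof -
  define b where "b = even (\<Sum>i = 1..Suc n. a (2 * i))"
  have prefix: "odd (a 1)" "\<forall>i\<in>{2..Suc n}. even (a (2 * i - 1))"
    "origin_after a m = transpose 2 3 \<circ> (if b then id else transpose 1 2)"
    using negative_prefix[OF assms(1), of n] m unfolding b_def by auto
  \<comment> \<open>Without \<open>b\<close> the strings end in the order 3, 1, 2, 4, so the right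
    arcs repeat the left pairs.\<close>
  have b
    using not_separated_even m unfolding prefix(3)
    by (cases b) (auto simp: transpose_heights)
  then show ?thesis
    using prefix(1,2) unfolding b_def by blast
qed

lemma negative_end_odd:
  assumes "s = -1" and m: "m = Suc (2 * Suc n)"
  shows "odd (a 1) \<and> (\<forall>i\<in>{2..Suc n}. even (a (2 * i - 1))) \<and> odd (a m) \<and>
         odd (\<Sum>i = 1..Suc n. a (2 * i))"
proof -
  define b where "b = even (\<Sum>i = 1..Suc n. a (2 * i))"
  have prefix: "odd (a 1)" "\<forall>i\<in>{2..Suc n}. even (a (2 * i - 1))"
    "origin_after a (2 * Suc n) = transpose 2 3 \<circ> (if b then id else transpose 1 2)"
    using negative_prefix[OF assms(1), of n] m unfolding b_def by auto
  have last: "origin_after a m = transpose 2 3 \<circ> (if b then id else transpose 1 2) \<circ>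
      (if even (a m) then id else transpose 2 3)"
    unfolding m odd_region prefix(3) ..
  have "odd m"
    using m by simp
  note right = right_end_odd[OF this] not_separated_odd[OF this]
  \<comment> \<open>Otherwise strings 1 and 3, which are parallel, would be joined at heights 1 and
    2.\<close>
  have "odd (a m)"
    using right(1,2) negative_left_end[OF assms(1)] m unfolding last
    by (intro notI; cases b) (simp_all add: transpose_heights)
  \<comment> \<open>Under \<open>b\<close> the two transpositions of 2 and 3 cancel, and the
    identity separates the diagram.\<close>
  moreover from this have "\<not> b"
    using right(3) unfolding last by (cases b) (auto simp: transpose_heights)
  ultimately show ?thesis
    using prefix(1,2) unfolding b_def by blast
qed

end

section \<open>Combining both signs and both parities of \<open>m\<close>\<close>

theorem proposition4p1:
  fixes m :: nat and a :: "nat \<Rightarrow> int" and d :: "point \<Rightarrow> direction"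
  assumes "m \<ge> 1"
    and "\<forall>i\<in>{1..m}. a i > 0"
    and "knot_diagram (two_bridge_diagram m a)"
    and "orientation (two_bridge_diagram m a) d"
    and "positive_diagram (two_bridge_diagram m a) d \<or>
         negative_diagram (two_bridge_diagram m a) d"
  shows "(\<forall>n. m = 2 * n \<longrightarrow>
            ((\<forall>i\<in>{1..n - 1}. even (a (2 * i))) \<and> odd (a (2 * n)) \<and>
              even (\<Sum>i = 1..n. a (2 * i - 1)))
          \<or> (odd (a 1) \<and> (\<forall>i\<in>{2..n}. even (a (2 * i - 1))) \<and>
              even (\<Sum>i = 1..n. a (2 * i))))
       \<and> (\<forall>n. m = 2 * n + 1 \<longrightarrow>
            ((\<forall>i\<in>{2..n}. even (a (2 * i - 1))) \<and> (odd (a 1) \<and> odd (a (2 * n + 1))) \<and>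
              odd (\<Sum>i = 1..n. a (2 * i)))
          \<or> ((\<forall>i\<in>{1..n}. even (a (2 * i))) \<and>
              odd (\<Sum>i = 1..n + 1. a (2 * i - 1))))"
proof -
  \<comment> \<open>Sign 1 yields the first alternative for even \<open>m\<close> and the second for
    odd \<open>m\<close>; sign -1 yields the other two, except when \<open>m = 1\<close>.\<close>
  define s :: int where "s = (if positive_diagram (two_bridge_diagram m a) d then 1 else -1)"
  interpret homogeneous_knot m a d s
    using assms
    by unfold_locales (auto simp: s_def positive_diagram_def negative_diagram_def split: if_splits)
  have s: "s = 1 \<or> s = -1"
    by (simp add: s_def)
  show ?thesis
  proof (intro conjI allI impI)
    fix n assume m: "m = 2 * n"
    with assms(1) obtain k where k: "n = Suc k"
      by (cases n) auto
    from s show "((\<forall>i\<in>{1..n - 1}. even (a (2 * i))) \<and> odd (a (2 * n)) \<and>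
          even (\<Sum>i = 1..n. a (2 * i - 1))) \<or>
        (odd (a 1) \<and> (\<forall>i\<in>{2..n}. even (a (2 * i - 1))) \<and> even (\<Sum>i = 1..n. a (2 * i)))"
    proof
      assume "s = 1"
      then show ?thesis
        using positive_end_even k m by simp
    next
      assume "s = -1"
      then show ?thesis
        using negative_end_even k m by simp
    qed
  next
    fix n assume m: "m = 2 * n + 1"
    from s show "((\<forall>i\<in>{2..n}. even (a (2 * i - 1))) \<and> (odd (a 1) \<and> odd (a (2 * n + 1))) \<and>
          odd (\<Sum>i = 1..n. a (2 * i))) \<or>
        ((\<forall>i\<in>{1..n}. even (a (2 * i))) \<and> odd (\<Sum>i = 1..n + 1. a (2 * i - 1)))"
    proof
      assume "s = 1"
      then show ?thesis
        using positive_end_odd m by simp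
    next
      assume "s = -1"
      show ?thesis
      proof (cases n)
        \<comment> \<open>A single region has no upper region after it to force anything;
          connectedness alone makes \<open>a 1\<close> odd, which is the second alternative.\<close>
        case 0
        then show ?thesis
          using not_separated_odd odd_region[of 0] m by (auto simp: origin_after_0)
      next
        case (Suc k)
        then show ?thesis
          using negative_end_odd[of k] m \<open>s = -1\<close> by simp
      qed
    qed
  qed
qed

end
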